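(* Let $D$ be an oriented graph on $n$ vertices. If $a(D)+\sum_{v\in V(D)}\omega^+(v)\geq n(n+1)/2$, then $D$ contains a directed triangle.
   Context: All graphs are simple and finite, with at least one vertex. An oriented graph is a digraph obtained from a simple undirected graph by replacing each edge with exactly one of the two possible arcs with the same ends. $a(D)$ denotes the number of arcs of $D$. For a vertex $v$ of $D$, $N^+(v)$ is the set of out-neighbors of $v$, $D[N^+(v)]$ is the subdigraph of $D$ induced by $N^+(v)$, and the out-component number $\omega^+(v)$ is the number of components of $D[N^+(v)]$, where components are the connected components of the underlying undirected graph (so $\omega^+(v)=0$ if $N^+(v)=\emptyset$). A directed triangle is a directed cycle of length 3. *)

theory Defs
  imports Complex_Main "Graph_Theory.Graph_Theory"
begin

locale oriented_graph = digraph +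
  assumes verts_nonempty: "verts G \<noteq> {}"
    and no_antiparallel: "u \<rightarrow>\<^bsub>G\<^esub> v \<Longrightarrow> \<not> v \<rightarrow>\<^bsub>G\<^esub> u"

definition out_neighbors :: "('a, 'b) pre_digraph \<Rightarrow> 'a \<Rightarrow> 'a set" where
  "out_neighbors D v = {w. v \<rightarrow>\<^bsub>D\<^esub> w}"

text \<open>Components of the underlying undirected graph are the strongly connected components of
  the symmetric closure.\<close>

definition components :: "('a, 'b) pre_digraph \<Rightarrow> ('a, 'a \<times> 'a) pre_digraph set" where
  "components D = pre_digraph.sccs (with_proj (mk_symmetric D))"

definition out_component_number :: "('a, 'b) pre_digraph \<Rightarrow> 'a \<Rightarrow> nat" where
  "out_component_number D v = card (components (D \<restriction> out_neighbors D v))"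

definition has_directed_triangle :: "('a, 'b) pre_digraph \<Rightarrow> bool" where
  "has_directed_triangle D \<longleftrightarrow> (\<exists>p. pre_digraph.cycle D p \<and> length p = 3)"

end

theory Submission
  imports Defs
begin

text \<open>
  Colour an arc \<open>v \<rightarrow> w\<close> by the pair of \<open>v\<close> and the component of \<open>D[N\<^sup>+(v)]\<close> containing \<open>w\<close>.
  This uses exactly \<open>\<Sum>v. \<omega>\<^sup>+(v)\<close> colours. In a transitive triangle the two arcs leaving the source
  have the same colour, so a rainbow triangle is a directed triangle, and it remains to show that a
  simple graph with \<open>e\<close> edges and \<open>c\<close> edge colours such that \<open>e + c \<ge> n(n+1)/2\<close> has a rainbow
  triangle (a theorem of Li, Ning, Xu and Zhang). Suppose that there is none, and let \<open>v\<close> maximise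
  the number \<open>s(v)\<close> of colours that occur only on edges at \<open>v\<close>. If
  \<open>s(v) > 0\<close>, let \<open>w\<close> be a neighbour of \<open>v\<close> along such a colour. Neighbours of \<open>v\<close> along the other
  colours private to \<open>v\<close> are not adjacent to \<open>w\<close>, so \<open>deg w + s(w) \<le> deg w + s(v) \<le> n\<close>; if
  \<open>s(v) = 0\<close>, then \<open>w = v\<close> satisfies the same bound. Deleting \<open>w\<close> lowers \<open>e + c\<close> by at most \<open>n\<close>,
  and induction on \<open>n\<close> applies.
\<close>

section \<open>Rainbow triangles in edge-coloured graphs\<close>

definition private_colours :: "'e set \<Rightarrow> ('e \<Rightarrow> 'a set) \<Rightarrow> ('e \<Rightarrow> 'c) \<Rightarrow> 'a \<Rightarrow> 'c set" where
  "private_colours E ends col v = col ` E - col ` {e \<in> E. v \<notin> ends e}"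

text \<open>Edges are abstract objects with an injective \<open>ends\<close>, so the arcs of a
  digraph can serve as edges directly. In \<open>no_rainbow\<close>, \<open>u\<close>,
  \<open>v\<close>, \<open>w\<close> are distinct because each end set has two elements.\<close>

locale rainbow_triangle_free =
  fixes V :: "'a set" and E :: "'e set" and ends :: "'e \<Rightarrow> 'a set" and col :: "'e \<Rightarrow> 'c"
  assumes finite_V: "finite V"
    and inj_ends: "inj_on ends E"
    and ends_edge: "e \<in> E \<Longrightarrow> ends e \<subseteq> V \<and> card (ends e) = 2"
    and no_rainbow: "\<lbrakk>e \<in> E; f \<in> E; g \<in> E; ends e = {u, v}; ends f = {v, w}; ends g = {u, w}\<rbrakk>
      \<Longrightarrow> col e = col f \<or> col f = col g \<or> col e = col g"
begin

lemma finite_E: "finite E"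
proof (rule inj_on_finite[OF inj_ends])
  show "ends ` E \<subseteq> Pow V" using ends_edge by auto
  show "finite (Pow V)" using finite_V by simp
qed

lemma edge_at:
  assumes "e \<in> E" "v \<in> ends e"
  obtains w where "ends e = {v, w}" "w \<in> V" "w \<noteq> v"
proof -
  obtain x y where "ends e = {x, y}" "x \<noteq> y" using ends_edge[OF assms(1)] by (auto simp: card_2_iff)
  with ends_edge[OF assms(1)] assms(2) have "ends e = {v, if v = x then y else x}"
    "(if v = x then y else x) \<in> V" "(if v = x then y else x) \<noteq> v" by auto
  then show thesis by (rule that)
qed

lemma finite_private: "finite (private_colours E ends col v)"
  unfolding private_colours_def using finite_E by simp

lemma private_edge:
  assumes "k \<in> private_colours E ends col v"
  obtains w e where "e \<in> E" "col e = k" "ends e = {v, w}" "w \<in> V" "w \<noteq> v"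
proof -
  obtain e where e: "e \<in> E" "col e = k" "v \<in> ends e"
    using assms unfolding private_colours_def by auto
  show thesis using edge_at[OF e(1,3)] e that by metis
qed

lemma private_colour_at:
  assumes "col e \<in> private_colours E ends col v" "e \<in> E"
  shows "v \<in> ends e"
  using assms unfolding private_colours_def by auto

text \<open>Since \<open>ends\<close> is injective, edges at \<open>w\<close> are counted by their
  other end.\<close>

lemma degree_le_neighbours:
  assumes "\<And>e x. e \<in> E \<Longrightarrow> ends e = {w, x} \<Longrightarrow> x \<noteq> w \<Longrightarrow> x \<in> N" "finite N"
  shows "card {e \<in> E. w \<in> ends e} \<le> card N"
proof -
  have "card {e \<in> E. w \<in> ends e} = card (ends ` {e \<in> E. w \<in> ends e})"
    using inj_ends by (intro card_image[symmetric]) (auto intro: inj_on_subset)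
  also have "\<dots> \<le> card ((\<lambda>x. {w, x}) ` N)"
  proof (rule card_mono)
    show "ends ` {e \<in> E. w \<in> ends e} \<subseteq> (\<lambda>x. {w, x}) ` N"
    proof clarify
      fix e assume e: "e \<in> E" "w \<in> ends e"
      from edge_at[OF this] obtain x where "ends e = {w, x}" "x \<noteq> w" by metis
      with assms(1) e show "ends e \<in> (\<lambda>x. {w, x}) ` N" by blast
    qed
  qed (use assms in simp)
  also have "\<dots> \<le> card N" using assms(2) by (rule card_image_le)
  finally show ?thesis .
qed

lemma small_vertex:
  assumes "V \<noteq> {}"
  shows "\<exists>v\<in>V. card {e \<in> E. v \<in> ends e} + card (private_colours E ends col v) \<le> card V"
proof -
  let ?P = "private_colours E ends col"
  obtain v where v: "v \<in> V" and max: "\<And>w. w \<in> V \<Longrightarrow> card (?P w) \<le> card (?P v)"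
  proof -
    have "Max ((\<lambda>v. card (?P v)) ` V) \<in> (\<lambda>v. card (?P v)) ` V"
      using assms finite_V by (intro Max_in) auto
    then obtain v where "v \<in> V" "card (?P v) = Max ((\<lambda>v. card (?P v)) ` V)" by auto
    then show thesis using that finite_V by auto
  qed
  show ?thesis
  proof (cases "?P v = {}")
    case True
    have "card {e \<in> E. v \<in> ends e} \<le> card V"
      using ends_edge finite_V by (intro degree_le_neighbours) auto
    with True v show ?thesis by (intro bexI[of _ v]) auto
  next
    case False
    then obtain k where k: "k \<in> ?P v" by auto
    from k obtain w e where e: "e \<in> E" "col e = k" "ends e = {v, w}" and w: "w \<in> V" "w \<noteq> v"
      by (rule private_edge)
    \<comment> \<open>\<open>k\<close> is set aside for the edge \<open>vw\<close>; each remaining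
      private colour selects a neighbour of \<open>v\<close>, and distinct colours select distinct
      neighbours.\<close>
    define K where "K = ?P v - {k}"
    have "\<exists>x. \<exists>f\<in>E. col f = k' \<and> ends f = {v, x} \<and> x \<in> V \<and> x \<noteq> v" if "k' \<in> K" for k'
      using that private_edge[of k' v] unfolding K_def by (metis Diff_iff)
    then obtain x where x: "\<And>k'. k' \<in> K \<Longrightarrow>
      \<exists>f\<in>E. col f = k' \<and> ends f = {v, x k'} \<and> x k' \<in> V \<and> x k' \<noteq> v" by metis
    have inj: "inj_on x K"
    proof (rule inj_onI)
      fix i j assume "i \<in> K" "j \<in> K" and eq: "x i = x j"
      from x[OF \<open>i \<in> K\<close>] obtain f where f: "f \<in> E" "col f = i" "ends f = {v, x i}" by blast
      from x[OF \<open>j \<in> K\<close>] obtain g where g: "g \<in> E" "col g = j" "ends g = {v, x j}" by blast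
      have "f = g" using inj_onD[OF inj_ends _ f(1) g(1)] f(3) g(3) eq by simp
      then show "i = j" using f(2) g(2) by simp
    qed
    have x_w: "x k' \<noteq> w" if "k' \<in> K" for k'
    proof
      assume "x k' = w"
      with x[OF \<open>k' \<in> K\<close>] obtain f where "f \<in> E" "col f = k'" "ends f = {v, w}" by metis
      then have "f = e" using e inj_ends by (metis inj_onD)
      then show False using \<open>col f = k'\<close> e that unfolding K_def by auto
    qed
    \<comment> \<open>Such a \<open>g\<close> would close a triangle on \<open>v\<close>,
      \<open>w\<close>, \<open>x k'\<close>. As \<open>g\<close> misses \<open>v\<close>, its colour
      is not private to \<open>v\<close>, hence differs from the distinct colours \<open>k\<close>
      and \<open>k'\<close>: a rainbow triangle.\<close>
    have non_adj: "ends g \<noteq> {w, x k'}" if k': "k' \<in> K" and gE: "g \<in> E" for k' g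
    proof
      assume g: "ends g = {w, x k'}"
      obtain f where f: "f \<in> E" "col f = k'" "ends f = {v, x k'}" "x k' \<noteq> v"
        using x[OF k'] by metis
      have "v \<notin> ends g" using g f w by auto
      then have "col g \<notin> ?P v" using private_colour_at gE by blast
      then have "col g \<noteq> k" "col g \<noteq> k'" using k k' unfolding K_def by auto
      moreover have "k \<noteq> k'" using k' unfolding K_def by auto
      ultimately show False using no_rainbow[OF f(1) gE e(1)] e f g by (auto simp: insert_commute)
    qed
    have sub: "x ` K \<subseteq> V - {w}" using x x_w by blast
    have "card {e \<in> E. w \<in> ends e} \<le> card (V - {w} - x ` K)"
    proof (rule degree_le_neighbours)
      fix g y assume g: "g \<in> E" "ends g = {w, y}" "y \<noteq> w"
      have "y \<notin> x ` K" using non_adj g(1,2) by blast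
      moreover have "y \<in> V" using ends_edge[OF g(1)] unfolding g(2) by blast
      ultimately show "y \<in> V - {w} - x ` K" using g(3) by blast
    qed (use finite_V in simp)
    also have "\<dots> = card V - 1 - card K"
      using card_Diff_subset[OF finite_subset[OF sub] sub] w finite_V card_image[OF inj] by simp
    finally have "card {e \<in> E. w \<in> ends e} \<le> card V - 1 - card K" .
    \<comment> \<open>This makes the truncated subtraction exact; the 1 lost for \<open>w\<close>
      itself then pays for the colour \<open>k\<close> missing from \<open>K\<close>.\<close>
    moreover have "card K \<le> card V - 1"
      using card_mono[OF _ sub] w finite_V card_image[OF inj] by simp
    moreover have "card (?P v) = card K + 1"
      unfolding K_def using card.remove[OF finite_private k] by simp
    moreover have "card V > 0" using w finite_V card_gt_0_iff by blast
    ultimately have "card {e \<in> E. w \<in> ends e} + card (?P w) \<le> card V"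
      using max[OF w(1)] by linarith
    then show ?thesis using w by auto
  qed
qed

lemma delete_vertex:
  "rainbow_triangle_free (V - {v}) {e \<in> E. v \<notin> ends e} ends col"
proof
  show "inj_on ends {e \<in> E. v \<notin> ends e}" using inj_ends by (rule inj_on_subset) auto
qed (use finite_V ends_edge no_rainbow in auto)

end

text \<open>Deleting the vertex from \<open>small_vertex\<close> removes its edges and exactly its
  private colours. The right side drops by \<open>2 * card V\<close>, so strictness is inherited
  from the single vertex, where it reads 0 < 2.\<close>

theorem rainbow_triangle_free_bound:
  assumes "rainbow_triangle_free V E ends col" "V \<noteq> {}"
  shows "2 * (card E + card (col ` E)) < card V * (card V + 1)"
  using assms
proof (induction "card V" arbitrary: V E)
  case 0
  then show ?case by (simp add: rainbow_triangle_free.finite_V)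
next
  case (Suc n)
  interpret rainbow_triangle_free V E ends col by fact
  obtain v where v: "v \<in> V"
    and small: "card {e \<in> E. v \<in> ends e} + card (private_colours E ends col v) \<le> card V"
    using small_vertex Suc.prems by auto
  let ?F = "{e \<in> E. v \<notin> ends e}"
  have "E = {e \<in> E. v \<in> ends e} \<union> ?F" by auto
  then have cE: "card E = card {e \<in> E. v \<in> ends e} + card ?F"
    using finite_E by (metis (no_types, lifting) card_Un_disjoint disjoint_iff finite_Un mem_Collect_eq)
  have "card (col ` ?F) \<le> card (col ` E)"
    using finite_E by (intro card_mono) auto
  moreover have "card (private_colours E ends col v) = card (col ` E) - card (col ` ?F)"
    unfolding private_colours_def using finite_E by (intro card_Diff_subset) auto
  ultimately have cC: "card (col ` E) = card (private_colours E ends col v) + card (col ` ?F)" by simp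
  have n: "card (V - {v}) = n" using v Suc.hyps(2) finite_V by simp
  show ?case
  proof (cases "V = {v}")
    case True
    have "E = {}"
    proof (rule ccontr)
      assume "E \<noteq> {}"
      then obtain e where "ends e \<subseteq> {v}" "card (ends e) = 2" using ends_edge True by blast
      then show False by (metis card_mono finite.emptyI finite_insert is_singletonI
            is_singleton_altdef not_less_eq_eq numeral_2_eq_2 order_refl One_nat_def)
    qed
    then show ?thesis using True by simp
  next
    case False
    with v have "V - {v} \<noteq> {}" by auto
    from Suc.hyps(1)[OF n[symmetric] delete_vertex this]
    have "2 * (card ?F + card (col ` ?F)) < n * (n + 1)" unfolding n .
    with small cE cC Suc.hyps(2)[symmetric] show ?thesis by (simp add: algebra_simps)
  qed
qed

section \<open>Colouring arcs by out-neighbourhood components\<close>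

lemma (in wf_digraph) directed_triangleI:
  assumes "u \<rightarrow>\<^bsub>G\<^esub> v" "v \<rightarrow>\<^bsub>G\<^esub> w" "w \<rightarrow>\<^bsub>G\<^esub> u" "u \<noteq> v" "v \<noteq> w" "u \<noteq> w"
  shows "has_directed_triangle G"
proof -
  obtain a b c where abc: "a \<in> arcs G" "tail G a = u" "head G a = v"
    "b \<in> arcs G" "tail G b = v" "head G b = w" "c \<in> arcs G" "tail G c = w" "head G c = u"
    using assms(1-3) by (auto simp: arcs_ends_conv)
  then have "awalk u [a, b, c] u" by (auto simp: awalk_simps)
  moreover have "distinct (tl (awalk_verts u [a, b, c]))" using abc assms by auto
  ultimately have "cycle [a, b, c]" unfolding cycle_def by blast
  then show ?thesis unfolding has_directed_triangle_def
    by (metis length_Cons list.size(3) numeral_3_eq_3)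
qed

definition component_of :: "('a, 'b) pre_digraph \<Rightarrow> 'a \<Rightarrow> 'a \<Rightarrow> 'a set" where
  "component_of D v w = pre_digraph.scc_of (with_proj (mk_symmetric (D \<restriction> out_neighbors D v))) w"

context wf_digraph
begin

lemma wf_out_neighbourhood: "wf_digraph (with_proj (mk_symmetric (G \<restriction> out_neighbors G v)))"
proof -
  have "out_neighbors G v \<subseteq> verts G" by (auto simp: out_neighbors_def)
  then have "wf_digraph (G \<restriction> out_neighbors G v)" by blast
  then interpret H: pair_wf_digraph "mk_symmetric (G \<restriction> out_neighbors G v)"
    by (rule wf_digraph.wellformed_mk_symmetric)
  show ?thesis by (rule H.wf_digraph)
qed

text \<open>Components are subdigraphs in \<open>components\<close> but vertex sets in
  \<open>component_of\<close>; passing to vertex sets preserves their number.\<close>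

lemma out_component_number_eq:
  "out_component_number G v = card (component_of G v ` out_neighbors G v)"
proof -
  let ?H = "with_proj (mk_symmetric (G \<restriction> out_neighbors G v))"
  interpret H: wf_digraph ?H by (rule wf_out_neighbourhood)
  have "out_component_number G v = card H.sccs_verts"
    unfolding out_component_number_def components_def by (simp add: H.card_sccs_verts)
  also have "H.sccs_verts = component_of G v ` out_neighbors G v"
    unfolding H.sccs_verts_conv_scc_of component_of_def by simp
  finally show ?thesis .
qed

text \<open>The arc lies inside the out-neighbourhood, and symmetrisation makes its ends mutually
  reachable.\<close>

lemma component_of_eq:
  assumes "v \<rightarrow>\<^bsub>G\<^esub> w" "v \<rightarrow>\<^bsub>G\<^esub> x" "w \<rightarrow>\<^bsub>G\<^esub> x"
  shows "component_of G v w = component_of G v x"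
proof -
  let ?H = "with_proj (mk_symmetric (G \<restriction> out_neighbors G v))"
  interpret H: wf_digraph ?H by (rule wf_out_neighbourhood)
  obtain a where "a \<in> arcs G" "tail G a = w" "head G a = x"
    using assms(3) by (auto simp: arcs_ends_conv)
  then have "w \<rightarrow>\<^bsub>?H\<^esub> x" "x \<rightarrow>\<^bsub>?H\<^esub> w"
    using assms(1,2) by (auto simp: parcs_mk_symmetric out_neighbors_def intro!: bexI[of _ a])
  then have "w \<rightarrow>\<^sup>*\<^bsub>?H\<^esub> x" "x \<rightarrow>\<^sup>*\<^bsub>?H\<^esub> w" by auto
  then show ?thesis unfolding component_of_def H.scc_of_def
    by (auto intro: H.reachable_trans)
qed

text \<open>Recording the tail keeps colours at different vertices distinct, so the colour set is a
  disjoint union over the vertices.\<close>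

definition arc_colour :: "'b \<Rightarrow> 'a \<times> 'a set" where
  "arc_colour a = (tail G a, component_of G (tail G a) (head G a))"

lemma arc_colour_transitive:
  assumes "v \<rightarrow>\<^bsub>G\<^esub> w" "v \<rightarrow>\<^bsub>G\<^esub> x" "w \<rightarrow>\<^bsub>G\<^esub> x \<or> x \<rightarrow>\<^bsub>G\<^esub> w"
    "tail G a = v" "head G a = w" "tail G b = v" "head G b = x"
  shows "arc_colour a = arc_colour b"
  using component_of_eq assms unfolding arc_colour_def by metis

end

lemma (in fin_digraph) card_arc_colours:
  "card (arc_colour ` arcs G) = (\<Sum>v\<in>verts G. out_component_number G v)"
proof -
  have N: "out_neighbors G v \<subseteq> verts G" for v by (auto simp: out_neighbors_def)
  have "arc_colour ` arcs G = (SIGMA v:verts G. component_of G v ` out_neighbors G v)"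
    unfolding arc_colour_def out_neighbors_def arcs_ends_conv by (auto simp: image_iff)
  then show ?thesis
    using N finite_subset[OF N] by (simp add: card_SigmaI out_component_number_eq)
qed

lemma (in oriented_graph) rainbow_triangle_freeI:
  assumes "\<not> has_directed_triangle G"
  shows "rainbow_triangle_free (verts G) (arcs G) (\<lambda>a. {tail G a, head G a}) arc_colour"
proof
  have dom: "tail G a \<rightarrow>\<^bsub>G\<^esub> head G a" if "a \<in> arcs G" for a
    using that by (auto simp: arcs_ends_conv)
  show "inj_on (\<lambda>a. {tail G a, head G a}) (arcs G)"
  proof (rule inj_onI)
    fix a b assume ab: "a \<in> arcs G" "b \<in> arcs G" "{tail G a, head G a} = {tail G b, head G b}"
    \<comment> \<open>The opposite orientation would make the arcs antiparallel.\<close>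
    then have "arc_to_ends G a = arc_to_ends G b"
      using dom[of a] dom[of b] no_antiparallel unfolding arc_to_ends_def
      by (metis doubleton_eq_iff)
    with ab show "a = b" using no_multi_arcs by blast
  qed
  show "{tail G a, head G a} \<subseteq> verts G \<and> card {tail G a, head G a} = 2" if "a \<in> arcs G" for a
    using that no_loops by auto
  fix e f g u v w
  assume E: "e \<in> arcs G" "f \<in> arcs G" "g \<in> arcs G"
    and ends: "{tail G e, head G e} = {u, v}" "{tail G f, head G f} = {v, w}"
      "{tail G g, head G g} = {u, w}"
  have neq: "u \<noteq> v" "v \<noteq> w" "u \<noteq> w" using E ends no_loops by (metis doubleton_eq_iff)+
  have cyc: "\<not> (x \<rightarrow>\<^bsub>G\<^esub> y \<and> y \<rightarrow>\<^bsub>G\<^esub> z \<and> z \<rightarrow>\<^bsub>G\<^esub> x)" if "x \<noteq> y" "y \<noteq> z" "x \<noteq> z" for x y z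
    using directed_triangleI assms that by blast
  have same: "arc_colour a = arc_colour b"
    if "a \<in> arcs G" "b \<in> arcs G" "c \<in> arcs G" "tail G a = tail G b"
      "{tail G c, head G c} = {head G a, head G b}" for a b c
  proof (rule arc_colour_transitive[OF _ _ _ refl refl])
    show "tail G a \<rightarrow>\<^bsub>G\<^esub> head G a" "tail G a \<rightarrow>\<^bsub>G\<^esub> head G b"
      using dom[of a] dom[of b] that by auto
    show "head G a \<rightarrow>\<^bsub>G\<^esub> head G b \<or> head G b \<rightarrow>\<^bsub>G\<^esub> head G a"
      using dom[of c] that by (auto simp: doubleton_eq_iff)
  qed (use that in auto)
  have oriented: "tail G e = u \<and> head G e = v \<or> tail G e = v \<and> head G e = u"
    "tail G f = v \<and> head G f = w \<or> tail G f = w \<and> head G f = v"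
    "tail G g = u \<and> head G g = w \<or> tail G g = w \<and> head G g = u"
    using ends by (simp_all add: doubleton_eq_iff)
  \<comment> \<open>Pairwise distinct tails leave only the two cyclic orientations, both excluded by
    \<open>cyc\<close>.\<close>
  consider "tail G e = tail G f" | "tail G f = tail G g" | "tail G e = tail G g"
    using oriented dom[OF E(1)] dom[OF E(2)] dom[OF E(3)] cyc[OF neq] cyc[of u w v] neq by auto
  then show "arc_colour e = arc_colour f \<or> arc_colour f = arc_colour g \<or> arc_colour e = arc_colour g"
  proof cases
    case 1
    then have "arc_colour e = arc_colour f"
      using oriented neq by (intro same[of e f g] E) auto
    then show ?thesis ..
  next
    case 2
    then have "arc_colour f = arc_colour g"
      using oriented neq by (intro same[of f g e] E) auto
    then show ?thesis by simp
  next
    case 3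
    then have "arc_colour e = arc_colour g"
      using oriented neq by (intro same[of e g f] E) auto
    then show ?thesis by simp
  qed
qed (rule finite_verts)

theorem theorem4:
  fixes D :: "('a, 'b) pre_digraph" and n :: nat
  assumes "oriented_graph D"
    and "card (verts D) = n"
    and "real (card (arcs D)) + (\<Sum>v\<in>verts D. real (out_component_number D v))
      \<ge> real n * (real n + 1) / 2"
  shows "has_directed_triangle D"
proof (rule ccontr)
  assume "\<not> has_directed_triangle D"
  interpret oriented_graph D by fact
  have "2 * (card (arcs D) + card (arc_colour ` arcs D)) < n * (n + 1)"
    using rainbow_triangle_free_bound[OF rainbow_triangle_freeI verts_nonempty]
      \<open>\<not> has_directed_triangle D\<close> assms(2) by simp
  then have "real (2 * (card (arcs D) + card (arc_colour ` arcs D))) < real (n * (n + 1))"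
    by (rule of_nat_less_iff[THEN iffD2])
  with assms(3) show False by (simp add: card_arc_colours algebra_simps)
qed

end
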